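(* Let $n\ge 1$, $R:=\mathbb{R}[x_1,\dots,x_n]$, and let $M$ be a maximal ideal of $R$. Then, after a suitable re-enumeration (permutation) of the variables $x_1,\dots,x_n$, there exist integers $k,m\ge 0$ with $k+m=n$, real numbers $r_1,\dots,r_k$, and numbers $a_1,\dots,a_m\in\mathbb{C}\setminus\mathbb{R}$ such that $M$ is generated by the polynomials $$p_j:=x_j-r_j\quad (j=1,\dots,k),$$ $$p_{k+j}:=x_{k+j}^2-(2\,\mathrm{Re}\,a_j)\,x_{k+j}+|a_j|^2\quad (j=1,\dots,m),$$ together with $2^{n-k}-2$ multilinear polynomials $q_j\in\mathbb{R}[x_{k+1},\dots,x_n]$ vanishing at the point $(a_1,\dots,a_m)$ (if $m=0$ there are no polynomials $q_j$). More precisely, $$M=\sum_{j=1}^n p_j\,R+\sum_{j=1}^{2^{n-k}-2} q_j\,\mathbb{R},$$ where the second sum is understood to be $\{0\}$ if $m=0$.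
   Context: A polynomial is called multilinear here if its degree in each variable is at most $1$, i.e. it is a real linear combination of monomials $x_{k+1}^{j_1}\cdots x_{k+m}^{j_m}$ with all $j_\ell\in\{0,1\}$. $p_jR$ denotes the principal ideal of $R$ generated by $p_j$, and $q_j\mathbb{R}$ denotes the set of real scalar multiples of $q_j$. *)

theory Defs
  imports
    Complex_Main
    "HOL-Library.Poly_Mapping"
    "HOL-Library.Set_Algebras"
    "HOL-Combinatorics.Permutations"
    "HOL-Algebra.Ideal"
begin

text \<open>
  Real polynomials in the variables \<open>x\<^sub>0, x\<^sub>1, \<dots>\<close>: a monomial is its finitely supported
  exponent function, a polynomial is its finitely supported coefficient function. The ring
  operations are those of the instance \<open>poly_mapping :: (monoid_add, semiring_0) ring\<close> etc.
\<close>
type_synonym rpoly = "(nat \<Rightarrow>\<^sub>0 nat) \<Rightarrow>\<^sub>0 real"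

definition Var :: "nat \<Rightarrow> rpoly" where
  "Var i = Poly_Mapping.single (Poly_Mapping.single i 1) 1"

definition Const :: "real \<Rightarrow> rpoly" where
  "Const c = Poly_Mapping.single 0 c"

definition polys_in :: "nat set \<Rightarrow> rpoly set" where
  "polys_in V = {p. \<forall>t \<in> Poly_Mapping.keys p. Poly_Mapping.keys t \<subseteq> V}"

definition poly_ring :: "nat set \<Rightarrow> rpoly ring" where
  "poly_ring V = \<lparr>carrier = polys_in V, mult = (*), one = 1, zero = 0, add = (+)\<rparr>"

definition poly_eval :: "(nat \<Rightarrow> complex) \<Rightarrow> rpoly \<Rightarrow> complex" where
  "poly_eval z p =
     (\<Sum>t \<in> Poly_Mapping.keys p.
        of_real (Poly_Mapping.lookup p t) *
        (\<Prod>i \<in> Poly_Mapping.keys t. z i ^ Poly_Mapping.lookup t i))"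

definition multilinear :: "rpoly \<Rightarrow> bool" where
  "multilinear p \<longleftrightarrow> (\<forall>t \<in> Poly_Mapping.keys p. \<forall>i. Poly_Mapping.lookup t i \<le> 1)"

lemma poly_ring_cring: "cring (poly_ring V)"
proof -
  have add: "p + q \<in> polys_in V" if "p \<in> polys_in V" "q \<in> polys_in V" for p q
    using that Poly_Mapping.keys_add[of p q] unfolding polys_in_def by blast
  have mult: "p * q \<in> polys_in V" if pq: "p \<in> polys_in V" "q \<in> polys_in V" for p q
  proof -
    have "Poly_Mapping.keys t \<subseteq> V" if t: "t \<in> Poly_Mapping.keys (p * q)" for t
    proof -
      obtain a b where ab: "t = a + b" "a \<in> Poly_Mapping.keys p" "b \<in> Poly_Mapping.keys q"
        using Poly_Mapping.keys_mult[of p q] t by blast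
      show ?thesis
        using Poly_Mapping.keys_add[of a b] ab pq unfolding polys_in_def by blast
    qed
    then show ?thesis unfolding polys_in_def by blast
  qed
  have neg: "- p \<in> polys_in V" if "p \<in> polys_in V" for p
    using that unfolding polys_in_def by simp
  have units: "0 \<in> polys_in V" "1 \<in> polys_in V"
    unfolding polys_in_def by simp_all
  show ?thesis
  proof (rule cringI)
    show "abelian_group (poly_ring V)"
    proof (rule abelian_groupI)
      fix x assume "x \<in> carrier (poly_ring V)"
      then have "- x \<in> carrier (poly_ring V) \<and>
          - x \<oplus>\<^bsub>poly_ring V\<^esub> x = \<zero>\<^bsub>poly_ring V\<^esub>"
        using neg by (simp add: poly_ring_def)
      then show "\<exists>y\<in>carrier (poly_ring V). y \<oplus>\<^bsub>poly_ring V\<^esub> x = \<zero>\<^bsub>poly_ring V\<^esub>"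
        by blast
    qed (simp_all add: poly_ring_def add units algebra_simps)
    show "comm_monoid (poly_ring V)"
      by (rule comm_monoidI) (simp_all add: poly_ring_def mult units algebra_simps)
  qed (simp add: poly_ring_def algebra_simps)
qed

end

(* Every variable is algebraic over the reals modulo M: otherwise the inverses of x - c, for the
   uncountably many reals c, would be linearly independent modulo M in a space of countable
   dimension. As M is prime, it then contains for each variable either x - r or an irreducible
   real quadratic. If some variable v is of the second kind, an affine function y of x_v satisfies
   y^2 = -1 modulo M, so that C embeds into the quotient; choosing for every other variable the
   conjugate root that agrees with this embedding gives a point a with x^S = a^S modulo M for every
   squarefree monomial, where a^S is read as Re + Im * y. The 2^m - 2 nontrivial differences
   x^S - a^S are the q_j, and they reduce every polynomial to some u + v y, which lies in M only
   if it is 0. *)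
theory Submission
  imports Defs
    "HOL-Computational_Algebra.Fundamental_Theorem_Algebra"
    "HOL-Analysis.Continuum_Not_Denumerable"
begin

section \<open>Constants, closure properties and induction for polynomials\<close>

lemma Const_0 [simp]: "Const 0 = 0"
  and Const_1 [simp]: "Const 1 = 1"
  and Const_add: "Const (a + b) = Const a + Const b"
  and Const_diff: "Const (a - b) = Const a - Const b"
  and Const_minus: "Const (- a) = - Const a"
  and Const_mult: "Const (a * b) = Const a * Const b"
  by (simp_all add: Const_def single_add single_diff single_uminus mult_single)

lemma Const_times_single: "Const c * Poly_Mapping.single t b = Poly_Mapping.single t (c * b)"
  by (simp add: Const_def mult_single)

lemma polys_in_closed [simp, intro]:
  shows polys_in_0: "0 \<in> polys_in V"
    and polys_in_1: "1 \<in> polys_in V"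
    and polys_in_Const: "Const c \<in> polys_in V"
    and polys_in_Var: "i \<in> V \<Longrightarrow> Var i \<in> polys_in V"
    and polys_in_add: "p \<in> polys_in V \<Longrightarrow> q \<in> polys_in V \<Longrightarrow> p + q \<in> polys_in V"
    and polys_in_minus: "p \<in> polys_in V \<Longrightarrow> - p \<in> polys_in V"
    and polys_in_diff: "p \<in> polys_in V \<Longrightarrow> q \<in> polys_in V \<Longrightarrow> p - q \<in> polys_in V"
    and polys_in_mult: "p \<in> polys_in V \<Longrightarrow> q \<in> polys_in V \<Longrightarrow> p * q \<in> polys_in V"
proof -
  interpret cring "poly_ring V" by (rule poly_ring_cring)
  show minus: "- p \<in> polys_in V" if "p \<in> polys_in V" for p
    using that by (simp add: polys_in_def)
  show add: "p + q \<in> polys_in V" if "p \<in> polys_in V" "q \<in> polys_in V" for p q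
    using a_closed[of p q] that by (simp add: poly_ring_def)
  show "p - q \<in> polys_in V" if "p \<in> polys_in V" "q \<in> polys_in V" for p q
    using add[OF that(1) minus[OF that(2)]] by simp
  show "p * q \<in> polys_in V" if "p \<in> polys_in V" "q \<in> polys_in V" for p q
    using m_closed[of p q] that by (simp add: poly_ring_def)
qed (auto simp: polys_in_def Const_def Var_def)

lemma polys_in_prod [intro]: "(\<And>i. i \<in> A \<Longrightarrow> f i \<in> polys_in V) \<Longrightarrow> (\<Prod>i\<in>A. f i) \<in> polys_in V"
  by (induction A rule: infinite_finite_induct) auto

lemma poly_mapping_eq_sum_single:
  "p = (\<Sum>t\<in>Poly_Mapping.keys p. Poly_Mapping.single t (Poly_Mapping.lookup p t))"
  by (rule poly_mapping_eqI)
    (auto simp: lookup_sum lookup_single when_def in_keys_iff sum.delta'[OF finite_keys])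

text \<open>Every monomial arises from 1 by multiplying in one variable at a time. The product case
  is limited to a single variable so that the rule applies to sets of polynomials that are not
  closed under multiplication, as in \<open>polys_in_subset_by_reduction\<close>.\<close>

lemma polys_in_induct [consumes 1, case_names one add const var]:
  assumes p: "p \<in> polys_in V"
    and one: "P 1"
    and add: "\<And>p q. P p \<Longrightarrow> P q \<Longrightarrow> P (p + q)"
    and const: "\<And>c p. P p \<Longrightarrow> P (Const c * p)"
    and var: "\<And>i p. i \<in> V \<Longrightarrow> P p \<Longrightarrow> P (Var i * p)"
  shows "P p"
proof -
  have var_power: "P (Var i ^ b * p)" if "i \<in> V" "P p" for i b p
    using that by (induction b) (auto simp: mult.assoc var)
  have Var_power: "Var i ^ b = Poly_Mapping.single (Poly_Mapping.single i b) 1" for i b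
    by (induction b) (simp_all add: Var_def mult_single single_add[symmetric])
  have mono: "P (Poly_Mapping.single t 1)" if "Poly_Mapping.keys t \<subseteq> V" for t
    using that
  proof (induction t rule: update_induct)
    case const
    then show ?case using one by simp
  next
    case (update f a b)
    have "Poly_Mapping.update a b f = Poly_Mapping.single a b + f"
      using update(1)
      by (intro poly_mapping_eqI) (auto simp: lookup_update lookup_add lookup_single in_keys_iff when_def)
    then have "Poly_Mapping.single (Poly_Mapping.update a b f) 1
        = Var a ^ b * Poly_Mapping.single f (1::real)"
      by (simp add: Var_power mult_single)
    moreover have "a \<in> V" "Poly_Mapping.keys f \<subseteq> V"
      using update(2,4) by (auto simp: keys_update split: if_splits)
    ultimately show ?case
      using var_power update.IH by simp
  qed
  \<comment> \<open>Zero is the multiple of 1 by the constant 0; it serves as the empty sum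
    below.\<close>
  have zero: "P 0"
    using const[of 1 0] one by simp
  have "P (\<Sum>t\<in>T. Poly_Mapping.single t (f t))"
    if "finite T" "\<And>t. t \<in> T \<Longrightarrow> Poly_Mapping.keys t \<subseteq> V" for T f
    using that
  proof (induction T)
    case (insert t T)
    have "P (Const (f t) * Poly_Mapping.single t 1)"
      by (intro const mono) (use insert in auto)
    then show ?case
      using insert add by (simp add: Const_times_single)
  qed (simp add: zero)
  then have "P (\<Sum>t\<in>Poly_Mapping.keys p. Poly_Mapping.single t (Poly_Mapping.lookup p t))"
    using p by (simp add: polys_in_def)
  then show ?thesis
    by (subst poly_mapping_eq_sum_single)
qed

section \<open>Univariate real polynomials evaluated at a variable\<close>

text \<open>Factorizations and degree arguments for \<open>real poly\<close> are transported along
  this ring homomorphism.\<close>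

definition poly_at :: "nat \<Rightarrow> real poly \<Rightarrow> rpoly" where
  "poly_at i g = poly (map_poly Const g) (Var i)"

lemma poly_at_0 [simp]: "poly_at i 0 = 0"
  and poly_at_pCons: "poly_at i (pCons c g) = Const c + Var i * poly_at i g"
  by (simp_all add: poly_at_def map_poly_pCons)

lemma poly_at_1 [simp]: "poly_at i 1 = 1"
  by (simp add: one_pCons poly_at_pCons)

lemma poly_at_add: "poly_at i (f + g) = poly_at i f + poly_at i g"
  by (induction f g rule: poly_induct2) (simp_all add: poly_at_pCons Const_add algebra_simps)

lemma poly_at_smult: "poly_at i (smult c g) = Const c * poly_at i g"
  by (induction g) (simp_all add: poly_at_pCons Const_mult algebra_simps)

lemma poly_at_mult: "poly_at i (f * g) = poly_at i f * poly_at i g"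
  by (induction f) (simp_all add: poly_at_pCons poly_at_add poly_at_smult algebra_simps)

lemma poly_at_sum: "poly_at i (\<Sum>a\<in>A. f a) = (\<Sum>a\<in>A. poly_at i (f a))"
  by (induction A rule: infinite_finite_induct) (simp_all add: poly_at_add)

lemma poly_at_prod: "poly_at i (\<Prod>a\<in>A. f a) = (\<Prod>a\<in>A. poly_at i (f a))"
  by (induction A rule: infinite_finite_induct) (simp_all add: poly_at_mult)

lemma poly_at_in_polys_in [intro]: "i \<in> V \<Longrightarrow> poly_at i g \<in> polys_in V"
  by (induction g) (auto simp: poly_at_pCons)

lemma poly_at_linear: "poly_at i [:- c, 1:] = Var i - Const c"
  by (simp add: poly_at_pCons Const_minus)

text \<open>For non-real \<open>a\<close> this is the minimal polynomial of \<open>a\<close> over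
  the reals; \<open>a\<close> and \<open>cnj a\<close> give the same one.\<close>

definition quad :: "nat \<Rightarrow> complex \<Rightarrow> rpoly" where
  "quad i a = Var i ^ 2 - Const (2 * Re a) * Var i + Const ((cmod a)\<^sup>2)"

lemma poly_at_quadratic: "poly_at i [:(cmod a)\<^sup>2, - 2 * Re a, 1:] = quad i a"
  by (simp add: poly_at_pCons Const_minus quad_def power2_eq_square algebra_simps)


text \<open>The fundamental theorem of algebra supplies a complex root z. If z is real, it splits
  off a linear factor; otherwise the minimal polynomial of z divides g, since the remainder is
  affine with real coefficients and still vanishes at z.\<close>

lemma real_poly_factor:
  fixes g :: "real poly"
  assumes "degree g > 0"
  obtains (linear) r where "[:- r, 1:] dvd g"
    | (quadratic) a where "a \<notin> \<real>" "[:(cmod a)\<^sup>2, - 2 * Re a, 1:] dvd g"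
proof -
  have "\<not> constant (poly (map_poly complex_of_real g))"
    using assms by (simp add: constant_degree degree_map_poly)
  then obtain z where z: "poly (map_poly complex_of_real g) z = 0"
    using fundamental_theorem_of_algebra by blast
  define ev where "ev f = poly (map_poly complex_of_real f) z" for f
  have ev_pCons: "ev (pCons c f) = of_real c + z * ev f" and ev_0 [simp]: "ev 0 = 0" for c f
    by (simp_all add: ev_def map_poly_pCons)
  have ev_add: "ev (f + h) = ev f + ev h" for f h
    by (induction f h rule: poly_induct2) (simp_all add: ev_pCons algebra_simps)
  have ev_smult: "ev (smult c f) = of_real c * ev f" for c f
    by (induction f) (simp_all add: ev_pCons algebra_simps)
  have ev_mult: "ev (f * h) = ev f * ev h" for f h
    by (induction f) (simp_all add: ev_pCons ev_add ev_smult algebra_simps)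
  show thesis
  proof (cases "z \<in> \<real>")
    case True
    then obtain r where r: "z = of_real r"
      by (auto elim: Reals_cases)
    have "ev f = of_real (poly f r)" for f
      by (induction f) (simp_all add: ev_pCons r)
    then have "poly g r = 0"
      using z by (simp add: ev_def)
    then show thesis
      by (intro linear[of r]) (simp add: poly_eq_0_iff_dvd)
  next
    case False
    define q where "q = [:(cmod z)\<^sup>2, - 2 * Re z, 1:]"
    have q: "ev q = 0" "q \<noteq> 0"
      by (auto simp: q_def ev_pCons complex_eq_iff power2_eq_square
          cmod_power2[unfolded power2_eq_square] algebra_simps)
    have "degree (g mod q) < 2"
      using degree_mod_less'[of q g] q(2) by (fastforce simp: q_def)
    then have "g mod q = [:coeff (g mod q) 0, coeff (g mod q) 1:]"
      by (intro poly_eqI) (auto simp: coeff_pCons coeff_eq_0 split: nat.splits)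
    then obtain b c where bc: "g mod q = [:b, c:]"
      by blast
    have "ev (g mod q) = 0"
      using z q ev_add[of "g div q * q" "g mod q"] ev_mult[of "g div q" q] by (simp add: ev_def)
    \<comment> \<open>The imaginary part of b + c z is c times Im z, and Im z is nonzero.\<close>
    then have "b = 0 \<and> c = 0"
      using False by (auto simp: bc ev_pCons complex_eq_iff complex_is_Real_iff)
    then have "q dvd g"
      using bc by (simp add: dvd_eq_mod_eq_0)
    then show thesis
      using False quadratic[of z] by (simp add: q_def)
  qed
qed

section \<open>Countably many monomials against uncountably many reals\<close>

lemma countable_finite_support: "countable (UNIV :: (nat \<Rightarrow>\<^sub>0 nat) set)"
proof (rule countableI')
  let ?graph = "\<lambda>t. (\<lambda>i. (i, Poly_Mapping.lookup t i)) ` Poly_Mapping.keys (t :: nat \<Rightarrow>\<^sub>0 nat)"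
  \<comment> \<open>A finitely supported function is determined by its graph over the support, and
    finite sets of pairs of naturals can be numbered.\<close>
  define enc where "enc t = to_nat_on (Collect finite) (?graph t)" for t
  have graph_iff: "(i, b) \<in> ?graph t \<longleftrightarrow> b \<noteq> 0 \<and> Poly_Mapping.lookup t i = b" for i b t
    by (auto simp: in_keys_iff)
  have "s = t" if "?graph s = ?graph t" for s t
  proof (rule poly_mapping_eqI)
    fix i
    show "Poly_Mapping.lookup s i = Poly_Mapping.lookup t i"
      using that graph_iff by (metis (no_types, lifting))
  qed
  then show "inj enc"
    unfolding enc_def
    by (intro injI) (metis (no_types, lifting) countable_Collect_finite finite_imageI finite_keys inj_on_to_nat_on inj_onD mem_Collect_eq)
qed

text \<open>Pigeonhole: there are only countably many finite sets of monomials, so finite fibres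
  would make the reals countable.\<close>

lemma infinite_same_keys:
  fixes h :: "real \<Rightarrow> rpoly"
  obtains T where "infinite {c. Poly_Mapping.keys (h c) = T}"
proof (rule ccontr)
  assume "\<not> thesis"
  then have fin: "finite {c. Poly_Mapping.keys (h c) = T}" for T
    using that by blast
  have "countable {T :: (nat \<Rightarrow>\<^sub>0 nat) set. finite T}"
    using countable_Collect_finite_subset[OF countable_finite_support] by simp
  then have "countable (\<Union>T\<in>{T. finite T}. {c. Poly_Mapping.keys (h c) = T})"
    by (rule countable_UN) (intro countable_finite fin)
  moreover have "(\<Union>T\<in>{T. finite T}. {c. Poly_Mapping.keys (h c) = T}) = UNIV"
    by (rule UNIV_eq_I[symmetric]) simp
  ultimately show False
    using uncountable_UNIV_real by simp
qed

lemma vector_space_rpoly: "vector_space (\<lambda>c p. Const c * p :: rpoly)"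
  by unfold_locales (simp_all add: Const_add Const_mult algebra_simps)

text \<open>Infinitely many distinct values of \<open>h\<close> share one finite support, hence lie
  in a space of finite dimension and cannot be independent.\<close>

lemma rpoly_linear_dependence:
  fixes h :: "real \<Rightarrow> rpoly"
  assumes inj: "inj h"
  obtains C l c where "finite C" "c \<in> C" "l c \<noteq> (0::real)" "(\<Sum>c\<in>C. Const (l c) * h c) = 0"
proof -
  interpret vector_space "\<lambda>c p. Const c * p :: rpoly" by (rule vector_space_rpoly)
  obtain T where inf: "infinite {c. Poly_Mapping.keys (h c) = T}"
    using infinite_same_keys by blast
  let ?A = "{c. Poly_Mapping.keys (h c) = T}" and ?B = "(\<lambda>t. Poly_Mapping.single t 1) ` T"
  have "finite T"
    using inf by (metis (mono_tags, lifting) Collect_empty_eq finite.emptyI finite_keys)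
  have "h c \<in> span ?B" if "c \<in> ?A" for c
  proof -
    have "h c = (\<Sum>t\<in>T. Const (Poly_Mapping.lookup (h c) t) * Poly_Mapping.single t 1)"
      using poly_mapping_eq_sum_single[of "h c"] that by (simp add: Const_times_single)
    also have "\<dots> \<in> span ?B"
      by (intro span_sum span_scale span_base) auto
    finally show ?thesis .
  qed
  moreover have "infinite (h ` ?A)"
    using inf inj finite_imageD inj_on_subset by blast
  ultimately have "dependent (h ` ?A)"
    using independent_span_bound[of ?B "h ` ?A"] \<open>finite T\<close> by auto
  then obtain S u v where S: "finite S" "S \<subseteq> h ` ?A" "(\<Sum>p\<in>S. Const (u p) * p) = 0"
      and v: "v \<in> S" "u v \<noteq> 0"
    unfolding dependent_explicit by blast
  \<comment> \<open>The dependence found is among values of \<open>h\<close>; injectivity turns it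
    into one indexed by the arguments.\<close>
  have Sh: "h ` (h -` S) = S"
    using S(2) by auto
  show thesis
  proof (rule that)
    show "finite (h -` S)"
      using S(1) inj by (simp add: finite_vimageI)
    show "the_inv h v \<in> h -` S" "u (h (the_inv h v)) \<noteq> 0"
      using v S(2) f_the_inv_into_f[OF inj, of v] by auto
    have "(\<Sum>c\<in>h -` S. Const (u (h c)) * h c) = (\<Sum>p\<in>h ` (h -` S). Const (u p) * p)"
      using inj by (subst sum.reindex) (auto intro: inj_on_subset)
    then show "(\<Sum>c\<in>h -` S. Const (u (h c)) * h c) = 0"
      using S(3) Sh by simp
  qed
qed

section \<open>Maximal ideals: arithmetic, inverses and algebraicity of the variables\<close>

locale maximal_rpoly_ideal =
  fixes V :: "nat set" and M :: "rpoly set"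
  assumes maximal: "maximalideal M (poly_ring V)"
begin

sublocale maximalideal M "poly_ring V"
  by (rule maximal)

sublocale cring "poly_ring V"
  by (rule poly_ring_cring)

lemma ideal_subset: "p \<in> M \<Longrightarrow> p \<in> polys_in V"
  using Icarr by (simp add: poly_ring_def)

lemma ideal_0: "0 \<in> M"
  using additive_subgroup.zero_closed[OF is_additive_subgroup] by (simp add: poly_ring_def)

lemma ideal_add: "p \<in> M \<Longrightarrow> q \<in> M \<Longrightarrow> p + q \<in> M"
  using additive_subgroup.a_closed[OF is_additive_subgroup] by (simp add: poly_ring_def)

lemma ideal_mult: "p \<in> polys_in V \<Longrightarrow> q \<in> M \<Longrightarrow> p * q \<in> M"
  using I_l_closed by (simp add: poly_ring_def)

lemma ideal_mult': "p \<in> M \<Longrightarrow> q \<in> polys_in V \<Longrightarrow> p * q \<in> M"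
  using ideal_mult[of q p] by (simp add: mult.commute)

lemma ideal_minus: "p \<in> M \<Longrightarrow> - p \<in> M"
  using ideal_mult[of "- 1" p] by auto

lemma ideal_diff: "p \<in> M \<Longrightarrow> q \<in> M \<Longrightarrow> p - q \<in> M"
  using ideal_add[of p "- q"] ideal_minus by simp

lemma ideal_sum: "(\<And>i. i \<in> A \<Longrightarrow> f i \<in> M) \<Longrightarrow> (\<Sum>i\<in>A. f i) \<in> M"
  by (induction A rule: infinite_finite_induct) (auto simp: ideal_0 ideal_add)

lemma one_notin: "1 \<notin> M"
  using one_imp_carrier I_notcarr by (auto simp: poly_ring_def)

lemma Const_in_ideal_iff: "Const c \<in> M \<longleftrightarrow> c = 0"
proof
  assume "Const c \<in> M"
  then have "Const (inverse c * c) \<in> M"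
    using ideal_mult by (auto simp: Const_mult)
  then show "c = 0"
    using one_notin by (cases "c = 0") auto
qed (simp add: ideal_0)

lemma ideal_prime:
  assumes "p \<in> polys_in V" "q \<in> polys_in V" "p * q \<in> M"
  shows "p \<in> M \<or> q \<in> M"
  using primeideal.I_prime[OF maximalideal_prime[OF maximal], of p q] assms
  by (simp add: poly_ring_def)

text \<open>The ideal generated by M and p is strictly larger than M, so by maximality it contains
  1.\<close>

lemma inverse_mod_ideal:
  assumes p: "p \<in> polys_in V" "p \<notin> M"
  obtains h where "h \<in> polys_in V" "h * p - 1 \<in> M"
proof -
  let ?J = "M <+>\<^bsub>poly_ring V\<^esub> PIdl\<^bsub>poly_ring V\<^esub> p"
  have J: "x \<in> ?J \<longleftrightarrow> (\<exists>m\<in>M. \<exists>h\<in>polys_in V. x = m + h * p)" for x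
    by (auto simp: set_add_def set_mult_def cgenideal_def poly_ring_def)
  have "p \<in> carrier (poly_ring V)"
    using p by (simp add: poly_ring_def)
  then have ideal: "ideal ?J (poly_ring V)"
    by (intro add_ideals is_ideal cgenideal_ideal)
  have "M \<subseteq> ?J"
    unfolding J subset_iff by (metis add.right_neutral mult_zero_left polys_in_0)
  moreover have "p \<in> ?J"
    unfolding J by (metis add.left_neutral ideal_0 mult_1 polys_in_1)
  ultimately have "?J = carrier (poly_ring V)"
    using I_maximal[OF ideal] ideal.Icarr[OF ideal] p by blast
  then have "1 \<in> ?J"
    by (simp add: poly_ring_def)
  then obtain m h where mh: "m \<in> M" "h \<in> polys_in V" "1 = m + h * p"
    unfolding J by blast
  then have "h * p - 1 = - m"
    by (simp add: algebra_simps)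
  then show thesis
    using that mh ideal_minus by simp
qed

text \<open>Unless some x - c already lies in M, choose an inverse \<open>h c\<close> of each x - c
  modulo M. A linear relation among these inverses, multiplied by the product of the x - d involved,
  becomes a polynomial relation for x.\<close>

lemma algebraic_mod_ideal:
  assumes i: "i \<in> V"
  obtains g where "g \<noteq> 0" "poly_at i g \<in> M"
proof (cases "\<exists>c. Var i - Const c \<in> M")
  case True
  then obtain c where "poly_at i [:- c, 1:] \<in> M"
    by (auto simp: poly_at_linear)
  then show thesis
    using that[of "[:- c, 1:]"] by simp
next
  case False
  let ?x = "\<lambda>c. Var i - Const c"
  have x: "?x c \<in> polys_in V" for c
    using i by auto
  have "\<exists>h. h \<in> polys_in V \<and> h * ?x c - 1 \<in> M" for c
    using inverse_mod_ideal[OF x] False by blast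
  then obtain h where h: "\<And>c. h c \<in> polys_in V" "\<And>c. h c * ?x c - 1 \<in> M"
    by metis
  have "inj h"
  proof (rule injI, rule ccontr)
    fix c d assume hcd: "h c = h d" and "c \<noteq> d"
    \<comment> \<open>Equal inverses of x - c and x - d force (c - d) h into M, hence h itself,
      which contradicts its being invertible modulo M.\<close>
    have "(h d * ?x d - 1) - (h c * ?x c - 1) = Const (c - d) * h c"
      using hcd by (simp add: Const_diff algebra_simps)
    then have "Const (c - d) * h c \<in> M"
      using ideal_diff[OF h(2) h(2)] by metis
    then have "h c \<in> M"
      using ideal_prime[of "Const (c - d)" "h c"] h(1) \<open>c \<noteq> d\<close> Const_in_ideal_iff by auto
    then have "h c * ?x c - (h c * ?x c - 1) \<in> M"
      by (intro ideal_diff h ideal_mult' x)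
    then show False
      using one_notin by simp
  qed
  then obtain C l c where C: "finite C" "c \<in> C" "l c \<noteq> (0::real)" and rel: "(\<Sum>c\<in>C. Const (l c) * h c) = 0"
    by (rule rpoly_linear_dependence)
  \<comment> \<open>The numerator of the sum of the fractions l c / (x - c) over their common
    denominator.\<close>
  define g where "g = (\<Sum>c\<in>C. smult (l c) (\<Prod>d\<in>C - {c}. [:- d, 1:]))"
  let ?X = "\<lambda>D. \<Prod>d\<in>D. ?x d"
  have X: "?X D \<in> polys_in V" for D
    using x by (intro polys_in_prod)
  \<comment> \<open>At the point c, every summand with b different from c contains the factor c -
    c.\<close>
  have "poly g c = (\<Sum>b\<in>C. l b * (\<Prod>d\<in>C - {b}. c - d))"
    by (simp add: g_def poly_sum poly_prod)
  also have "\<dots> = (\<Sum>b\<in>C. if b = c then l c * (\<Prod>d\<in>C - {c}. c - d) else 0)"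
    using C by (intro sum.cong) (auto intro!: prod_zero)
  finally have "poly g c \<noteq> 0"
    using C by simp
  then have "g \<noteq> 0"
    by auto
  moreover have "poly_at i g \<in> M"
  proof -
    have X_remove: "?x b * ?X (C - {b}) = ?X C" if "b \<in> C" for b
      using that C(1) by (simp add: prod.remove)
    \<comment> \<open>Modulo M, multiplying the full product by \<open>h b\<close> cancels its
      factor x - b; the correction term is a multiple of \<open>h b * ?x b - 1\<close>.\<close>
    have "Const (l b) * ?X (C - {b}) = Const (l b) * h b * ?X C
        - (Const (l b) * ?X (C - {b})) * (h b * ?x b - 1)" if "b \<in> C" for b
      unfolding X_remove[OF that, symmetric] by (simp add: algebra_simps)
    then have "poly_at i g = (\<Sum>b\<in>C. Const (l b) * h b * ?X C
        - (Const (l b) * ?X (C - {b})) * (h b * ?x b - 1))"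
      by (simp add: g_def poly_at_sum poly_at_smult poly_at_prod poly_at_linear)
    also have "\<dots> = (\<Sum>b\<in>C. Const (l b) * h b) * ?X C
        - (\<Sum>b\<in>C. (Const (l b) * ?X (C - {b})) * (h b * ?x b - 1))"
      by (simp only: sum_subtractf sum_distrib_right)
    also have "\<dots> \<in> M"
    proof (rule ideal_diff)
      show "(\<Sum>b\<in>C. Const (l b) * h b) * ?X C \<in> M"
        by (simp add: rel ideal_0)
      show "(\<Sum>b\<in>C. (Const (l b) * ?X (C - {b})) * (h b * ?x b - 1)) \<in> M"
        by (intro ideal_sum ideal_mult h polys_in_mult X polys_in_Const)
    qed
    finally show ?thesis .
  qed
  ultimately show thesis
    using that by blast
qed

text \<open>Induction on the degree of a polynomial relation: M is prime, so it contains either the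
  irreducible factor split off or the cofactor, which has smaller degree.\<close>

lemma linear_or_quadratic_mod_ideal:
  assumes i: "i \<in> V"
  shows "(\<exists>r. Var i - Const r \<in> M) \<or> (\<exists>a. a \<notin> \<real> \<and> quad i a \<in> M)"
proof -
  obtain g where "g \<noteq> 0" "poly_at i g \<in> M"
    using algebraic_mod_ideal[OF i] .
  then show ?thesis
  proof (induction "degree g" arbitrary: g rule: less_induct)
    case less
    \<comment> \<open>The last premise stands for the induction hypothesis applied to the
      cofactor.\<close>
    have split: "poly_at i f \<in> M" if f: "f dvd g" "degree f > 0"
      and "\<And>h. h \<noteq> 0 \<Longrightarrow> poly_at i h \<in> M \<Longrightarrow> degree h < degree g \<Longrightarrow> poly_at i f \<in> M" for f
    proof -
      obtain h where h: "g = f * h"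
        using f by (elim dvdE)
      with less.prems have "f \<noteq> 0" "h \<noteq> 0"
        by auto
      then have "degree h < degree g"
        using h f by (simp add: degree_mult_eq)
      moreover have "poly_at i f \<in> M \<or> poly_at i h \<in> M"
        using less.prems(2) i unfolding h poly_at_mult by (intro ideal_prime) auto
      ultimately show ?thesis
        using that(3)[of h] \<open>h \<noteq> 0\<close> by blast
    qed
    show ?case
    proof (rule ccontr)
      assume neg: "\<not> ?thesis"
      then have smaller: "h \<noteq> 0 \<Longrightarrow> poly_at i h \<in> M \<Longrightarrow> degree h < degree g \<Longrightarrow> False" for h
        using less.hyps by blast
      have "degree g > 0"
      proof (rule ccontr)
        assume "\<not> degree g > 0"
        then obtain c where "g = [:c:]"
          by (auto elim: degree_eq_zeroE)
        then show False
          using less.prems by (simp add: poly_at_pCons Const_in_ideal_iff)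
      qed
      then show False
      proof (cases rule: real_poly_factor)
        case (linear r)
        have "poly_at i [:- r, 1:] \<in> M"
          by (rule split[OF linear(1)]) (simp, use smaller in blast)
        then show False
          using neg by (auto simp: poly_at_linear)
      next
        case (quadratic a)
        have "poly_at i [:(cmod a)\<^sup>2, - 2 * Re a, 1:] \<in> M"
          by (rule split[OF quadratic(2)]) (simp, use smaller in blast)
        then show False
          using neg quadratic(1) by (auto simp only: poly_at_quadratic)
      qed
    qed
  qed
qed

end

section \<open>A copy of the complex numbers modulo the ideal\<close>

text \<open>Completing the square shows that (x - Re a) / Im a is a square root of -1 modulo
  \<open>quad i a\<close>.\<close>

lemma quad_eq_sum_squares: "quad i a = (Var i - Const (Re a)) ^ 2 + Const ((Im a)\<^sup>2)"
proof -
  have two: "Const 2 = 2"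
    by (simp add: Const_def)
  show ?thesis
    unfolding quad_def cmod_power2
    by (simp add: two Const_add Const_mult power2_eq_square algebra_simps)
qed

text \<open>Modulo an ideal containing \<open>y\<^sup>2 + 1\<close> this is a ring homomorphism from the complex numbers.\<close>

definition complex_at :: "rpoly \<Rightarrow> complex \<Rightarrow> rpoly" where
  "complex_at y w = Const (Re w) + Const (Im w) * y"

text \<open>These are identities of polynomials: the defect of multiplicativity is an explicit
  multiple of \<open>y^2 + 1\<close>, which any ideal containing \<open>y^2 + 1\<close>
  absorbs.\<close>

lemma
  shows complex_at_1: "complex_at y 1 = 1"
    and complex_at_add: "complex_at y (w + w') = complex_at y w + complex_at y w'"
    and complex_at_of_real_mult: "complex_at y (of_real c * w) = Const c * complex_at y w"
    and complex_at_mult: "complex_at y w * complex_at y w' =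
          complex_at y (w * w') + Const (Im w * Im w') * (y\<^sup>2 + 1)"
  by (simp_all add: complex_at_def Const_add Const_diff Const_mult power2_eq_square algebra_simps)

text \<open>Obtained by solving x = Re a + Im a * y for y.\<close>

definition imag_unit :: "nat \<Rightarrow> complex \<Rightarrow> rpoly" where
  "imag_unit i a = Const (1 / Im a) * (Var i - Const (Re a))"

lemma complex_at_imag_unit: "Im a \<noteq> 0 \<Longrightarrow> complex_at (imag_unit i a) a = Var i"
proof -
  assume "Im a \<noteq> 0"
  then have "Const (Im a) * Const (1 / Im a) = 1"
    by (simp add: Const_mult[symmetric])
  then show ?thesis
    by (simp add: complex_at_def imag_unit_def mult.assoc[symmetric])
qed

lemma imag_unit_squared: "Im a \<noteq> 0 \<Longrightarrow> (imag_unit i a)\<^sup>2 + 1 = Const (1 / (Im a)\<^sup>2) * quad i a"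
proof -
  assume a: "Im a \<noteq> 0"
  have "Const (1 / (Im a)\<^sup>2) = Const (1 / Im a) ^ 2" "Const (1 / (Im a)\<^sup>2) * Const ((Im a)\<^sup>2) = 1"
    using a by (simp_all add: Const_mult[symmetric] power2_eq_square)
  then show ?thesis
    by (simp add: imag_unit_def quad_eq_sum_squares power_mult_distrib distrib_left)
qed

lemma imag_unit_in_polys_in: "i \<in> V \<Longrightarrow> imag_unit i a \<in> polys_in V"
  by (auto simp: imag_unit_def)

lemma complex_at_in_polys_in: "y \<in> polys_in V \<Longrightarrow> complex_at y w \<in> polys_in V"
  by (auto simp: complex_at_def)

section \<open>Squarefree monomials and multilinearity\<close>

definition exponent_one :: "nat set \<Rightarrow> nat \<Rightarrow>\<^sub>0 nat" where
  "exponent_one S = (\<Sum>i\<in>S. Poly_Mapping.single i 1)"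

definition squarefree_monom :: "nat set \<Rightarrow> rpoly" where
  "squarefree_monom S = Poly_Mapping.single (exponent_one S) 1"

lemma squarefree_monom_empty [simp]: "squarefree_monom {} = 1"
  by (simp add: squarefree_monom_def exponent_one_def)

lemma squarefree_monom_insert:
  "finite S \<Longrightarrow> i \<notin> S \<Longrightarrow> squarefree_monom (insert i S) = Var i * squarefree_monom S"
  by (simp add: squarefree_monom_def exponent_one_def Var_def mult_single)

lemma lookup_exponent_one:
  "finite S \<Longrightarrow> Poly_Mapping.lookup (exponent_one S) j = (if j \<in> S then 1 else 0)"
  by (simp add: exponent_one_def lookup_sum lookup_single when_def)

lemma keys_exponent_one: "finite S \<Longrightarrow> Poly_Mapping.keys (exponent_one S) = S"
  by (auto simp: in_keys_iff lookup_exponent_one split: if_splits)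

lemma squarefree_monom_in_polys_in: "finite S \<Longrightarrow> S \<subseteq> V \<Longrightarrow> squarefree_monom S \<in> polys_in V"
  by (simp add: squarefree_monom_def polys_in_def keys_exponent_one)

lemma multilinear_diff: "multilinear p \<Longrightarrow> multilinear q \<Longrightarrow> multilinear (p - q)"
  and multilinear_add: "multilinear p \<Longrightarrow> multilinear q \<Longrightarrow> multilinear (p + q)"
  using keys_diff[of p q] Poly_Mapping.keys_add[of p q] unfolding multilinear_def by blast+

lemma multilinear_Const_mult: "multilinear p \<Longrightarrow> multilinear (Const c * p)"
  using Poly_Mapping.keys_mult[of "Const c" p]
  by (fastforce simp: multilinear_def Const_def split: if_splits)

lemma multilinear_squarefree_monom: "finite S \<Longrightarrow> multilinear (squarefree_monom S)"
  by (simp add: multilinear_def squarefree_monom_def lookup_exponent_one)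

lemma multilinear_Const: "multilinear (Const c)"
  and multilinear_Var: "multilinear (Var i)"
  by (auto simp: multilinear_def Const_def Var_def lookup_single when_def split: if_splits)

lemma multilinear_complex_at: "multilinear y \<Longrightarrow> multilinear (complex_at y w)"
  by (simp add: complex_at_def multilinear_add multilinear_Const multilinear_Const_mult)

text \<open>The imaginary unit is affine in one variable. This is why subtracting a value of
  \<open>complex_at\<close> from a squarefree monomial keeps it multilinear.\<close>

lemma multilinear_imag_unit: "multilinear (imag_unit i a)"
  by (simp add: imag_unit_def multilinear_diff multilinear_Const multilinear_Var multilinear_Const_mult)

section \<open>Evaluation at complex points\<close>

text \<open>Padding with zero coefficients puts polynomials with different supports over one index
  set, where evaluation is compared termwise.\<close>

lemma poly_eval_superset:
  assumes "finite T" "Poly_Mapping.keys p \<subseteq> T"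
  shows "poly_eval z p = (\<Sum>t\<in>T. of_real (Poly_Mapping.lookup p t) *
           (\<Prod>i\<in>Poly_Mapping.keys t. z i ^ Poly_Mapping.lookup t i))"
  unfolding poly_eval_def using assms
  by (intro sum.mono_neutral_left) (auto simp: in_keys_iff)

text \<open>Evaluation is treated as a real-linear map: the generators to be evaluated are real
  combinations of squarefree monomials, whose values are computed directly.\<close>

lemma poly_eval_add: "poly_eval z (p + q) = poly_eval z p + poly_eval z q"
proof -
  let ?T = "Poly_Mapping.keys p \<union> Poly_Mapping.keys q"
  have "finite ?T" "Poly_Mapping.keys p \<subseteq> ?T" "Poly_Mapping.keys q \<subseteq> ?T"
    "Poly_Mapping.keys (p + q) \<subseteq> ?T"
    using Poly_Mapping.keys_add[of p q] by auto
  note this(1) and eval = this(2-4)[THEN poly_eval_superset[OF this(1)]]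
  show ?thesis
    unfolding eval lookup_add of_real_add distrib_right sum.distrib ..
qed

lemma poly_eval_Const_mult: "poly_eval z (Const c * p) = of_real c * poly_eval z p"
proof -
  have lookup: "Poly_Mapping.lookup (Const c * p) t = c * Poly_Mapping.lookup p t" for t
    by (simp add: Const_def mult_map_scale_conv_mult[symmetric] map.rep_eq when_def)
  then have "Poly_Mapping.keys (Const c * p) \<subseteq> Poly_Mapping.keys p"
    by (auto simp: in_keys_iff)
  from poly_eval_superset[OF finite_keys this] show ?thesis
    unfolding poly_eval_def[of z p] lookup of_real_mult mult.assoc sum_distrib_left .
qed

lemma poly_eval_diff: "poly_eval z (p - q) = poly_eval z p - poly_eval z q"
  using poly_eval_add[of z p "Const (- 1) * q"] poly_eval_Const_mult[of z "- 1" q]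
  by (simp add: Const_minus)

lemma poly_eval_squarefree_monom: "finite S \<Longrightarrow> poly_eval z (squarefree_monom S) = (\<Prod>i\<in>S. z i)"
  by (simp add: poly_eval_def squarefree_monom_def keys_exponent_one lookup_exponent_one)

lemma poly_eval_Const: "poly_eval z (Const c) = of_real c"
  and poly_eval_Var: "poly_eval z (Var i) = z i"
  by (auto simp: poly_eval_def Const_def Var_def)

lemma poly_eval_complex_at: "poly_eval z y = \<i> \<Longrightarrow> poly_eval z (complex_at y w) = w"
  by (simp add: complex_at_def poly_eval_add poly_eval_Const poly_eval_Const_mult complex_eq_iff)

lemma poly_eval_imag_unit: "Im a \<noteq> 0 \<Longrightarrow> z i = a \<Longrightarrow> poly_eval z (imag_unit i a) = \<i>"
  by (simp add: imag_unit_def poly_eval_Const_mult poly_eval_diff poly_eval_Const poly_eval_Var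
      complex_eq_iff)

section \<open>Reduction to squarefree monomials in the quadratic variables\<close>

text \<open>The \<open>P i\<close> act as rewrite rules: linear ones replace a variable by a
  constant, quadratic ones lower a square. The target set \<open>A\<close> is kept abstract because
  the normal forms are real constants in one application and values of \<open>complex_at\<close> in
  the other.\<close>

lemma polys_in_subset_by_reduction:
  assumes fin: "finite V"
    and add: "\<And>f g. f \<in> A \<Longrightarrow> g \<in> A \<Longrightarrow> f + g \<in> A"
    and const: "\<And>c f. f \<in> A \<Longrightarrow> Const c * f \<in> A"
    and gen: "\<And>i h. i \<in> V \<Longrightarrow> h \<in> polys_in V \<Longrightarrow> h * P i \<in> A"
    and linear: "\<And>i. i \<in> B \<Longrightarrow> P i = Var i - Const (r i)"
    and quadratic: "\<And>i. i \<in> V - B \<Longrightarrow> P i = quad i (a i)"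
    and monom: "\<And>S. S \<subseteq> V - B \<Longrightarrow> squarefree_monom S \<in> A"
  shows "polys_in V \<subseteq> A"
proof
  fix f assume f: "f \<in> polys_in V"
  \<comment> \<open>Strengthened to all squarefree multiples of f, since multiplying by a variable
    may change the monomial; the empty S gives back f.\<close>
  then have "f \<in> polys_in V \<and> (\<forall>S. S \<subseteq> V - B \<longrightarrow> f * squarefree_monom S \<in> A)"
  proof (induction rule: polys_in_induct)
    case one
    then show ?case by (simp add: monom)
  next
    case (add p q)
    then show ?case by (auto simp: distrib_right intro: assms(2))
  next
    case (const c p)
    then show ?case by (auto simp: mult.assoc intro: assms(3))
  next
    case (var i p)
    have "Var i * p * squarefree_monom S \<in> A" if S: "S \<subseteq> V - B" for S
    proof -
      have finS: "finite S"
        using fin S by (meson finite_Diff finite_subset)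
      have IH: "p * squarefree_monom T \<in> A" if "T \<subseteq> V - B" for T
        using var that by blast
      have gen': "p * squarefree_monom T * P i \<in> A" if "T \<subseteq> S" for T
        using var that S finS by (intro gen polys_in_mult squarefree_monom_in_polys_in)
          (auto intro: finite_subset)
      \<comment> \<open>The variable is replaced by a constant, is absorbed into the squarefree
        monomial, or creates a square that \<open>quad\<close> reduces.\<close>
      consider "i \<in> B" | "i \<notin> B" "i \<notin> S" | "i \<in> S"
        by blast
      then show ?thesis
      proof cases
        case 1
        have "Var i * p * squarefree_monom S =
            p * squarefree_monom S * P i + Const (r i) * (p * squarefree_monom S)"
          by (simp add: linear[OF 1] algebra_simps)
        then show ?thesis
          using add const gen'[of S] IH[OF S] by simp
      next
        case 2
        have "insert i S \<subseteq> V - B"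
          using S var 2 by blast
        from IH[OF this] show ?thesis
          unfolding squarefree_monom_insert[OF finS 2(2)] by (simp only: mult_ac)
      next
        case 3
        define T where "T = S - {i}"
        have T: "squarefree_monom S = Var i * squarefree_monom T"
          using squarefree_monom_insert[of T i] finS 3 by (simp add: T_def insert_absorb)
        have P: "P i = quad i (a i)"
          using 3 S quadratic by blast
        have "Var i * p * squarefree_monom S = p * squarefree_monom T * P i
            + (Const (2 * Re (a i)) * (p * squarefree_monom S)
              + Const (- (cmod (a i))\<^sup>2) * (p * squarefree_monom T))"
          unfolding T P quad_def by (simp add: Const_minus power2_eq_square algebra_simps)
        moreover have "T \<subseteq> S"
          by (auto simp: T_def)
        ultimately show ?thesis
          using add const gen'[of T] IH[OF S] IH[of T] S by simp
      qed
    qed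
    then show ?case
      using var by auto
  qed
  from conjunct2[OF this, rule_format, of "{}"] show "f \<in> A"
    by simp
qed

section \<open>Congruences between monomials and complex values\<close>

context maximal_rpoly_ideal
begin

text \<open>A nonzero w has an inverse in the complex numbers, so its image is a unit modulo
  M.\<close>

lemma complex_at_in_ideal_iff:
  assumes y: "y \<in> polys_in V" "y\<^sup>2 + 1 \<in> M"
  shows "complex_at y w \<in> M \<longleftrightarrow> w = 0"
proof
  assume "complex_at y w \<in> M"
  then have "complex_at y (1 / w) * complex_at y w - Const (Im (1 / w) * Im w) * (y\<^sup>2 + 1) \<in> M"
    using y by (intro ideal_diff ideal_mult complex_at_in_polys_in polys_in_Const)
  then have "complex_at y (1 / w * w) \<in> M"
    by (simp add: complex_at_mult)
  then show "w = 0"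
    using one_notin by (cases "w = 0") (auto simp: complex_at_1)
qed (simp add: complex_at_def ideal_0)

lemma squarefree_monom_cong_complex_at:
  assumes y: "y \<in> polys_in V" "y\<^sup>2 + 1 \<in> M"
    and "finite S" "S \<subseteq> V" "\<And>i. i \<in> S \<Longrightarrow> Var i - complex_at y (a i) \<in> M"
  shows "squarefree_monom S - complex_at y (\<Prod>i\<in>S. a i) \<in> M"
  using assms(3-5)
proof (induction S)
  case empty
  then show ?case by (simp add: complex_at_1 ideal_0)
next
  case (insert i S)
  let ?w = "\<Prod>i\<in>S. a i"
  \<comment> \<open>The splitting x s - a w = s (x - a) + a (s - w), corrected by the defect in
    \<open>complex_at_mult\<close>.\<close>
  have "squarefree_monom (insert i S) - complex_at y (\<Prod>i\<in>insert i S. a i) =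
      squarefree_monom S * (Var i - complex_at y (a i))
      + complex_at y (a i) * (squarefree_monom S - complex_at y ?w)
      + Const (Im (a i) * Im ?w) * (y\<^sup>2 + 1)"
    using insert.hyps complex_at_mult[of y "a i" ?w]
    by (simp add: squarefree_monom_insert algebra_simps)
  also have "\<dots> \<in> M"
    by (rule ideal_add[OF ideal_add[OF ideal_mult ideal_mult] ideal_mult])
      (use insert y in \<open>auto intro!: complex_at_in_polys_in squarefree_monom_in_polys_in\<close>)
  finally show ?case .
qed

text \<open>Modulo the ideal, a root of a real quadratic is one of the two conjugate roots over the
  copy of \<open>\<complex>\<close>; choosing that conjugate for every variable makes the choices consistent.\<close>

lemma consistent_conjugate:
  assumes y: "y \<in> polys_in V" "y\<^sup>2 + 1 \<in> M"
    and i: "i \<in> V" and q: "quad i b \<in> M" and b: "b \<notin> \<real>"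
  obtains a where "a \<notin> \<real>" "quad i a \<in> M" "Var i - complex_at y a \<in> M"
proof -
  \<comment> \<open>The product of the two conjugate factors is (x - Re b)^2 - (Im b)^2 y^2;
    primality of M then selects one factor.\<close>
  have "(Var i - complex_at y b) * (Var i - complex_at y (cnj b))
      = quad i b - Const ((Im b)\<^sup>2) * (y\<^sup>2 + 1)"
    by (simp add: complex_at_def quad_eq_sum_squares Const_minus Const_mult power2_eq_square algebra_simps)
  also have "\<dots> \<in> M"
    using q y by (intro ideal_diff ideal_mult) auto
  finally have "Var i - complex_at y b \<in> M \<or> Var i - complex_at y (cnj b) \<in> M"
    using i y(1) by (intro ideal_prime) (auto intro: complex_at_in_polys_in)
  moreover have "quad i (cnj b) = quad i b"
    by (simp add: quad_def)
  moreover have "cnj b \<notin> \<real>"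
    using b by (simp add: complex_is_Real_iff)
  ultimately show thesis
    using that[of b] that[of "cnj b"] q b by auto
qed

end

section \<open>Sums of principal ideals and real lines\<close>

lemma in_sum_sets_iff:
  assumes "finite I"
  shows "x \<in> (\<Sum>i\<in>I. {f i h | h. h \<in> H}) \<longleftrightarrow> (\<exists>h. (\<forall>i\<in>I. h i \<in> H) \<and> x = (\<Sum>i\<in>I. f i (h i)))"
proof
  assume "x \<in> (\<Sum>i\<in>I. {f i h | h. h \<in> H})"
  then obtain s where s: "x = sum s I" "\<forall>i\<in>I. \<exists>h. s i = f i h \<and> h \<in> H"
    unfolding set_sum_alt[OF assms] by auto
  from s(2) obtain h where "\<forall>i\<in>I. s i = f i (h i) \<and> h i \<in> H"
    by metis
  with s(1) show "\<exists>h. (\<forall>i\<in>I. h i \<in> H) \<and> x = (\<Sum>i\<in>I. f i (h i))"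
    by (intro exI[of _ h]) simp
qed (unfold set_sum_alt[OF assms], blast)

lemma PIdl_poly_ring: "PIdl\<^bsub>poly_ring V\<^esub> p = {h * p | h. h \<in> polys_in V}"
  by (simp add: cgenideal_def poly_ring_def)

text \<open>The index type of \<open>q\<close> is left open: the multilinear generators are first
  indexed by sets of variables and in the end by numbers.\<close>

locale ideal_plus_span =
  fixes V I :: "nat set" and P :: "nat \<Rightarrow> rpoly" and F :: "'a set" and q :: "'a \<Rightarrow> rpoly"
  assumes finite_I: "finite I" and finite_F: "finite F"
begin

definition W :: "rpoly set" where
  "W = (\<Sum>i\<in>I. PIdl\<^bsub>poly_ring V\<^esub> (P i)) + (\<Sum>S\<in>F. {Const c * q S | c. True})"

lemma W_iff: "f \<in> W \<longleftrightarrow> (\<exists>h c. (\<forall>i\<in>I. h i \<in> polys_in V) \<and>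
    f = (\<Sum>i\<in>I. h i * P i) + (\<Sum>S\<in>F. Const (c S) * q S))"
proof -
  have 1: "x \<in> (\<Sum>i\<in>I. PIdl\<^bsub>poly_ring V\<^esub> (P i)) \<longleftrightarrow>
      (\<exists>h. (\<forall>i\<in>I. h i \<in> polys_in V) \<and> x = (\<Sum>i\<in>I. h i * P i))" for x
    unfolding PIdl_poly_ring by (rule in_sum_sets_iff[OF finite_I])
  have 2: "x \<in> (\<Sum>S\<in>F. {Const c * q S | c. True}) \<longleftrightarrow> (\<exists>c. x = (\<Sum>S\<in>F. Const (c S) * q S))" for x
    using in_sum_sets_iff[OF finite_F, of x "\<lambda>S c. Const c * q S" UNIV] by simp
  show ?thesis
  proof
    assume "f \<in> W"
    then obtain x y where "f = x + y" "x \<in> (\<Sum>i\<in>I. PIdl\<^bsub>poly_ring V\<^esub> (P i))"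
      "y \<in> (\<Sum>S\<in>F. {Const c * q S | c. True})"
      unfolding W_def by (rule set_plus_elim)
    then show "\<exists>h c. (\<forall>i\<in>I. h i \<in> polys_in V) \<and>
        f = (\<Sum>i\<in>I. h i * P i) + (\<Sum>S\<in>F. Const (c S) * q S)"
      unfolding 1 2 by blast
  next
    assume "\<exists>h c. (\<forall>i\<in>I. h i \<in> polys_in V) \<and>
        f = (\<Sum>i\<in>I. h i * P i) + (\<Sum>S\<in>F. Const (c S) * q S)"
    then show "f \<in> W"
      unfolding W_def using 1 2 by blast
  qed
qed

lemma W_add: "f \<in> W \<Longrightarrow> g \<in> W \<Longrightarrow> f + g \<in> W"
proof -
  assume "f \<in> W" "g \<in> W"
  then obtain h c h' c' where
    h: "\<forall>i\<in>I. h i \<in> polys_in V" "f = (\<Sum>i\<in>I. h i * P i) + (\<Sum>S\<in>F. Const (c S) * q S)" and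
    h': "\<forall>i\<in>I. h' i \<in> polys_in V" "g = (\<Sum>i\<in>I. h' i * P i) + (\<Sum>S\<in>F. Const (c' S) * q S)"
    unfolding W_iff by blast
  then show ?thesis
    unfolding W_iff
    by (intro exI[of _ "\<lambda>i. h i + h' i"] exI[of _ "\<lambda>S. c S + c' S"])
      (simp add: Const_add distrib_right sum.distrib)
qed

lemma W_Const_mult: "f \<in> W \<Longrightarrow> Const d * f \<in> W"
proof -
  assume "f \<in> W"
  then obtain h c where
    h: "\<forall>i\<in>I. h i \<in> polys_in V" "f = (\<Sum>i\<in>I. h i * P i) + (\<Sum>S\<in>F. Const (c S) * q S)"
    unfolding W_iff by blast
  then show ?thesis
    unfolding W_iff
    by (intro exI[of _ "\<lambda>i. Const d * h i"] exI[of _ "\<lambda>S. d * c S"])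
      (simp add: Const_mult distrib_left sum_distrib_left mult.assoc)
qed

lemma W_mult_P: "i \<in> I \<Longrightarrow> h \<in> polys_in V \<Longrightarrow> h * P i \<in> W"
  unfolding W_iff
  by (intro exI[of _ "\<lambda>j. if j = i then h else 0"] exI[of _ "\<lambda>_. 0"])
    (simp add: if_distrib[of "\<lambda>x. x * _"] finite_I cong: if_cong)

lemma W_q: "S \<in> F \<Longrightarrow> q S \<in> W"
  unfolding W_iff
  by (intro exI[of _ "\<lambda>_. 0"] exI[of _ "\<lambda>T. if T = S then 1 else 0"])
    (simp add: if_distrib[of Const] if_distrib[of "\<lambda>x. x * _"] finite_F cong: if_cong)

lemma W_0: "0 \<in> W"
  unfolding W_iff by (intro exI[of _ "\<lambda>_. 0"]) simp

text \<open>Stated for an arbitrary ideal so as to apply both to M and to the ideal generated by the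
  generators.\<close>

lemma W_subset_ideal:
  assumes J: "ideal J (poly_ring V)" and P: "P ` I \<subseteq> J" and q: "q ` F \<subseteq> J"
  shows "W \<subseteq> J"
proof
  interpret J: ideal J "poly_ring V" by (rule J)
  have add: "x + y \<in> J" if "x \<in> J" "y \<in> J" for x y
    using additive_subgroup.a_closed[OF J.is_additive_subgroup that] by (simp add: poly_ring_def)
  have zero: "0 \<in> J"
    using additive_subgroup.zero_closed[OF J.is_additive_subgroup] by (simp add: poly_ring_def)
  have sum: "(\<Sum>i\<in>K. f i) \<in> J" if "\<And>i. i \<in> K \<Longrightarrow> f i \<in> J" for K and f :: "'k \<Rightarrow> rpoly"
    using that by (induction K rule: infinite_finite_induct) (auto simp: zero add)
  have mult: "h * x \<in> J" if "h \<in> polys_in V" "x \<in> J" for h x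
    using J.I_l_closed[of x h] that by (simp add: poly_ring_def)
  fix f assume "f \<in> W"
  then show "f \<in> J"
    unfolding W_iff using P q by (auto intro!: add sum mult)
qed

end

section \<open>The generators in the original enumeration\<close>

context maximal_rpoly_ideal
begin

text \<open>The inclusion of M in \<open>W\<close> is division with remainder: an element of M is
  congruent modulo \<open>W\<close> to a normal form, which then lies in M and must vanish.\<close>

lemma generators:
  assumes fin: "finite V"
  obtains B a P r F q where
    "B \<subseteq> V"
    "\<forall>i\<in>V - B. a i \<notin> \<real>"
    "\<forall>i\<in>B. P i = Var i - Const (r i)"
    "\<forall>i\<in>V - B. P i = quad i (a i)"
    "finite F" "card F = (if V = B then 0 else 2 ^ card (V - B) - 2)"
    "\<forall>S\<in>F. q S \<in> polys_in (V - B) \<and> multilinear (q S)"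
    "\<forall>S\<in>F. \<forall>z. (\<forall>i\<in>V - B. z i = a i) \<longrightarrow> poly_eval z (q S) = 0"
    "P ` V \<subseteq> M" "q ` F \<subseteq> M"
    "M \<subseteq> (\<Sum>i\<in>V. PIdl\<^bsub>poly_ring V\<^esub> (P i)) + (\<Sum>S\<in>(F :: nat set set). {Const c * q S | c. True})"
proof -
  define B where "B = {i \<in> V. \<exists>r. Var i - Const r \<in> M}"
  define r where "r i = (SOME r. Var i - Const r \<in> M)" for i
  have r: "Var i - Const (r i) \<in> M" if "i \<in> B" for i
    using someI_ex[of "\<lambda>r. Var i - Const r \<in> M"] that by (simp add: B_def r_def)
  have BV: "B \<subseteq> V"
    by (auto simp: B_def)
  have quadratic: "\<exists>b. b \<notin> \<real> \<and> quad i b \<in> M" if "i \<in> V - B" for i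
    using linear_or_quadratic_mod_ideal[of i] that by (auto simp: B_def)
  show thesis
  proof (cases "V = B")
    case True
    define P where "P i = Var i - Const (r i)" for i
    have PM: "P ` V \<subseteq> M"
      using r True by (auto simp: P_def)
    interpret ideal_plus_span V V P "{} :: nat set set" "\<lambda>_. 0"
      using fin by unfold_locales auto
    \<comment> \<open>All variables are real constants modulo M here, so the normal forms are
      constants.\<close>
    define A where "A = {f. \<exists>c. f - Const c \<in> W}"
    have "W \<subseteq> M"
      by (rule W_subset_ideal[OF is_ideal PM]) simp
    have "polys_in V \<subseteq> A"
    proof (rule polys_in_subset_by_reduction[OF fin])
      show "P i = Var i - Const (r i)" for i
        by (simp add: P_def)
      show "f + g \<in> A" if fg: "f \<in> A" "g \<in> A" for f g
      proof -
        obtain c d where "f - Const c \<in> W" "g - Const d \<in> W"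
          using fg by (auto simp: A_def)
        then have "f + g - Const (c + d) \<in> W"
          using W_add[of "f - Const c" "g - Const d"] by (simp add: Const_add algebra_simps)
        then show ?thesis
          by (auto simp: A_def)
      qed
      show "Const c * f \<in> A" if f: "f \<in> A" for c f
      proof -
        obtain d where "f - Const d \<in> W"
          using f by (auto simp: A_def)
        then have "Const c * f - Const (c * d) \<in> W"
          using W_Const_mult[of "f - Const d" c] by (simp add: Const_mult algebra_simps)
        then show ?thesis
          by (auto simp: A_def)
      qed
      show "h * P i \<in> A" if "i \<in> V" "h \<in> polys_in V" for i h
        using W_mult_P[OF that] by (auto simp: A_def intro!: exI[of _ 0])
      show "squarefree_monom S \<in> A" if "S \<subseteq> V - B" for S
        using that True W_0 by (auto simp: A_def intro!: exI[of _ 1])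
    qed (use True in auto)
    have "M \<subseteq> W"
    proof
      fix f assume f: "f \<in> M"
      then obtain c where c: "f - Const c \<in> W"
        using \<open>polys_in V \<subseteq> A\<close> ideal_subset by (auto simp: A_def)
      then have "f - (f - Const c) \<in> M"
        using \<open>W \<subseteq> M\<close> f ideal_diff by blast
      then show "f \<in> W"
        using c by (simp add: Const_in_ideal_iff)
    qed
    then have M: "M \<subseteq> (\<Sum>i\<in>V. PIdl\<^bsub>poly_ring V\<^esub> (P i))
        + (\<Sum>S\<in>({} :: nat set set). {Const c * (0 :: rpoly) | c. True})"
      by (simp only: W_def)
    \<comment> \<open>Since \<open>V - B\<close> is empty, there is no complex root to choose and
      \<open>a\<close> may be arbitrary.\<close>
    show thesis
      by (rule that[of B undefined P r "{}" "\<lambda>_. 0"]) (use BV True PM M in \<open>auto simp: P_def\<close>)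
  next
    case False
    with BV obtain v where v: "v \<in> V - B"
      by blast
    then obtain b where b: "b \<notin> \<real>" "quad v b \<in> M"
      using quadratic by blast
    then have Imb: "Im b \<noteq> 0"
      by (simp add: complex_is_Real_iff)
    define y where "y = imag_unit v b"
    have y: "y \<in> polys_in V" "y\<^sup>2 + 1 \<in> M"
      using v b Imb unfolding y_def imag_unit_squared[OF Imb]
      by (auto intro: imag_unit_in_polys_in ideal_mult)
    have Var_v: "complex_at y b = Var v"
      using complex_at_imag_unit[OF Imb] by (simp add: y_def)
    have "\<exists>c. c \<notin> \<real> \<and> quad i c \<in> M \<and> Var i - complex_at y c \<in> M" if "i \<in> V - B" for i
    proof -
      from quadratic[OF that] obtain c where "c \<notin> \<real>" "quad i c \<in> M"
        by blast
      then show ?thesis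
        using consistent_conjugate[OF y, of i c] that by blast
    qed
    then obtain a' where a': "a' i \<notin> \<real> \<and> quad i (a' i) \<in> M \<and> Var i - complex_at y (a' i) \<in> M"
      if "i \<in> V - B" for i
      by metis
    \<comment> \<open>With the value b at \<open>v\<close>, x_v equals
      \<open>complex_at y (a v)\<close> as a polynomial and not only modulo M; hence
      \<open>q {v}\<close> is exactly 0.\<close>
    define a where "a = a'(v := b)"
    have a: "a i \<notin> \<real>" "quad i (a i) \<in> M" "Var i - complex_at y (a i) \<in> M" if "i \<in> V - B" for i
      using a'[OF that] b Var_v by (auto simp: a_def ideal_0)
    have av: "a v = b"
      by (simp add: a_def)
    define P where "P i = (if i \<in> B then Var i - Const (r i) else quad i (a i))" for i
    have PM: "P ` V \<subseteq> M"
      using r a(2) by (auto simp: P_def)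
    \<comment> \<open>The monomials \<open>1\<close> and \<open>x\<^sub>v\<close> are themselves values of \<open>complex_at y\<close>, so they give no generator.\<close>
    define F where "F = Pow (V - B) - {{}, {v}}"
    define q where "q S = squarefree_monom S - complex_at y (\<Prod>i\<in>S. a i)" for S
    have finite_sub: "finite S" if "S \<subseteq> V - B" for S
      using that fin by (meson finite_Diff finite_subset)
    have finF: "finite F"
      using fin by (simp add: F_def)
    \<comment> \<open>The two removed sets are distinct subsets of \<open>V - B\<close>, because v
      belongs to it.\<close>
    have cardF: "card F = 2 ^ card (V - B) - 2"
      using v fin unfolding F_def by (subst card_Diff_subset) (auto simp: card_Pow)
    have qM: "q ` F \<subseteq> M"
      unfolding q_def F_def
      by (auto intro!: squarefree_monom_cong_complex_at[OF y] a(3) finite_sub)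
    interpret ideal_plus_span V V P F q
      using fin finF by unfold_locales
    \<comment> \<open>Now the normal forms are the values of \<open>complex_at y\<close>, a real
      plane spanned by 1 and y.\<close>
    define A where "A = {f. \<exists>w. f - complex_at y w \<in> W}"
    have WM: "W \<subseteq> M"
      by (rule W_subset_ideal[OF is_ideal PM qM])
    have "polys_in V \<subseteq> A"
    proof (rule polys_in_subset_by_reduction[OF fin])
      show "f + g \<in> A" if fg: "f \<in> A" "g \<in> A" for f g
      proof -
        obtain c d where "f - complex_at y c \<in> W" "g - complex_at y d \<in> W"
          using fg by (auto simp: A_def)
        then have "f + g - complex_at y (c + d) \<in> W"
          using W_add[of "f - complex_at y c" "g - complex_at y d"]
          by (simp add: complex_at_add algebra_simps)
        then show ?thesis
          by (auto simp: A_def)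
      qed
      show "Const c * f \<in> A" if f: "f \<in> A" for c f
      proof -
        obtain d where "f - complex_at y d \<in> W"
          using f by (auto simp: A_def)
        then have "Const c * f - complex_at y (of_real c * d) \<in> W"
          using W_Const_mult[of "f - complex_at y d" c]
          by (simp only: complex_at_of_real_mult right_diff_distrib)
        then show ?thesis
          by (auto simp: A_def)
      qed
      show "h * P i \<in> A" if "i \<in> V" "h \<in> polys_in V" for i h
        using W_mult_P[OF that] by (auto simp: A_def complex_at_def intro!: exI[of _ 0])
      show "P i = Var i - Const (r i)" if "i \<in> B" for i
        using that by (simp add: P_def)
      show "P i = quad i (a i)" if "i \<in> V - B" for i
        using that by (simp add: P_def)
      show "squarefree_monom S \<in> A" if S: "S \<subseteq> V - B" for S
      proof -
        have "q S \<in> W"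
        proof (cases "S \<in> F")
          case True
          then show ?thesis by (rule W_q)
        next
          case False
          \<comment> \<open>The excluded sets are the empty set and {v}, where the monomial
            coincides with its complex value.\<close>
          then have "q S = 0"
            using S squarefree_monom_insert[of "{}" v]
            by (auto simp: F_def q_def complex_at_1 av Var_v)
          then show ?thesis
            using W_0 by simp
        qed
        then show ?thesis
          by (auto simp: A_def q_def)
      qed
    qed
    have "M \<subseteq> W"
    proof
      fix f assume f: "f \<in> M"
      then obtain w where w: "f - complex_at y w \<in> W"
        using \<open>polys_in V \<subseteq> A\<close> ideal_subset by (auto simp: A_def)
      then have "f - (f - complex_at y w) \<in> M"
        using WM f ideal_diff by blast
      then have "w = 0"
        using complex_at_in_ideal_iff[OF y] by simp
      then show "f \<in> W"
        using w by (simp add: complex_at_def)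
    qed
    then have MW: "M \<subseteq> (\<Sum>i\<in>V. PIdl\<^bsub>poly_ring V\<^esub> (P i)) + (\<Sum>S\<in>F. {Const c * q S | c. True})"
      by (simp only: W_def)
    have q: "q S \<in> polys_in (V - B)" "multilinear (q S)"
      and eval: "\<forall>i\<in>V - B. z i = a i \<Longrightarrow> poly_eval z (q S) = 0" if "S \<in> F" for S z
    proof -
      have S: "S \<subseteq> V - B"
        using that by (auto simp: F_def)
      show "q S \<in> polys_in (V - B)"
        using S v unfolding q_def y_def
        by (auto intro!: squarefree_monom_in_polys_in complex_at_in_polys_in
            imag_unit_in_polys_in finite_sub)
      show "multilinear (q S)"
        unfolding q_def y_def
        by (intro multilinear_diff multilinear_squarefree_monom multilinear_complex_at
            multilinear_imag_unit finite_sub S)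
      assume z: "\<forall>i\<in>V - B. z i = a i"
      \<comment> \<open>At the point a, the polynomial y takes the value of the imaginary unit, so
        \<open>complex_at y w\<close> evaluates to w.\<close>
      have "poly_eval z y = \<i>"
        using z v av Imb by (simp add: y_def poly_eval_imag_unit)
      then have "poly_eval z (q S) = (\<Prod>i\<in>S. z i) - (\<Prod>i\<in>S. a i)"
        by (simp add: q_def poly_eval_diff poly_eval_complex_at poly_eval_squarefree_monom finite_sub[OF S])
      also have "\<dots> = 0"
        using S z by (auto intro!: prod.cong)
      finally show "poly_eval z (q S) = 0" .
    qed
    show thesis
      by (rule that[of B a P r F q])
        (use BV a(1) finF cardF False q eval PM qM MW in \<open>auto simp: P_def\<close>)
  qed
qed

end

section \<open>Re-enumeration of the variables and conclusion\<close>

text \<open>Glue a bijection from the initial segment onto \<open>B\<close> with one from the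
  remaining indices onto the complement, and fix everything outside.\<close>

lemma permutes_onto_initial_segment:
  assumes "B \<subseteq> {1..n}"
  obtains \<sigma> where "\<sigma> permutes {1..n}" "\<sigma> ` {1..card B} = B"
    "\<sigma> ` {card B + 1..n} = {1..n} - B"
proof -
  have fin: "finite B"
    using assms finite_subset by blast
  have card: "card B \<le> n"
    using card_mono[OF _ assms] by simp
  obtain f where f: "bij_betw f {1..card B} B"
    using fin by (metis ex_bij_betw_nat_finite_1)
  have "card {card B + 1..n} = card ({1..n} - B)"
    using card_Diff_subset[OF fin assms] by simp
  then obtain g where g: "bij_betw g {card B + 1..n} ({1..n} - B)"
    using finite_same_card_bij[of "{card B + 1..n}" "{1..n} - B"] by auto
  define \<sigma> where "\<sigma> i = (if i \<in> {1..card B} then f i else if i \<in> {card B + 1..n} then g i else i)" for i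
  have 1: "bij_betw \<sigma> {1..card B} B"
    by (subst bij_betw_cong[of _ _ f]) (auto simp: \<sigma>_def f simp del: One_nat_def)
  have 2: "bij_betw \<sigma> {card B + 1..n} ({1..n} - B)"
    by (subst bij_betw_cong[of _ _ g]) (auto simp: \<sigma>_def g[simplified] g)
  have split: "{1..card B} \<union> {card B + 1..n} = {1..n}" "B \<union> ({1..n} - B) = {1..n}"
    using card assms by auto
  have "bij_betw \<sigma> {1..n} {1..n}"
    using bij_betw_combine[OF 1 2] unfolding split by blast
  moreover have "\<sigma> i = i" if "i \<notin> {1..n}" for i
    using that card by (auto simp: \<sigma>_def)
  ultimately have "\<sigma> permutes {1..n}"
    by (rule bij_imp_permutes)
  then show thesis
    using that 1 2 by (simp add: bij_betw_def)
qed

theorem theorem1p5: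
  fixes n :: nat and M :: "rpoly set"
  assumes "n \<ge> 1"
    and "maximalideal M (poly_ring {1..n})"
  shows "\<exists>(\<sigma> :: nat \<Rightarrow> nat) (k :: nat) (m :: nat) (r :: nat \<Rightarrow> real) (a :: nat \<Rightarrow> complex)
           (p :: nat \<Rightarrow> rpoly) (q :: nat \<Rightarrow> rpoly) (N :: nat).
     \<sigma> permutes {1..n} \<and> k + m = n \<and>
     (\<forall>j\<in>{1..m}. a j \<notin> \<real>) \<and>
     (\<forall>j\<in>{1..k}. p j = Var (\<sigma> j) - Const (r j)) \<and>
     (\<forall>j\<in>{1..m}. p (k + j) =
        Var (\<sigma> (k + j)) ^ 2 - Const (2 * Re (a j)) * Var (\<sigma> (k + j)) + Const ((cmod (a j))\<^sup>2)) \<and>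
     N = (if m = 0 then 0 else 2 ^ (n - k) - 2) \<and>
     (\<forall>j\<in>{1..N}. q j \<in> polys_in (\<sigma> ` {k+1..n}) \<and> multilinear (q j) \<and>
        (\<forall>z. (\<forall>i\<in>{1..m}. z (\<sigma> (k + i)) = a i) \<longrightarrow> poly_eval z (q j) = 0)) \<and>
     M = Idl\<^bsub>poly_ring {1..n}\<^esub> (p ` {1..n} \<union> q ` {1..N}) \<and>
     M = (\<Sum>j\<in>{1..n}. PIdl\<^bsub>poly_ring {1..n}\<^esub> (p j)) + (\<Sum>j\<in>{1..N}. {Const c * q j | c. True})"
proof -
  define V where "V = {1..n}"
  interpret maximal_rpoly_ideal V M
    using assms(2) unfolding V_def by (rule maximal_rpoly_ideal.intro)
  have finV: "finite V"
    by (simp add: V_def)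
  obtain B a P r F q where BV: "B \<subseteq> V" and a: "\<forall>i\<in>V - B. a i \<notin> \<real>"
    and PB: "\<forall>i\<in>B. P i = Var i - Const (r i)" and PC: "\<forall>i\<in>V - B. P i = quad i (a i)"
    and F: "finite (F :: nat set set)" "card F = (if V = B then 0 else 2 ^ card (V - B) - 2)"
    and q: "\<forall>S\<in>F. q S \<in> polys_in (V - B) \<and> multilinear (q S)"
      "\<forall>S\<in>F. \<forall>z. (\<forall>i\<in>V - B. z i = a i) \<longrightarrow> poly_eval z (q S) = 0"
    and gen: "P ` V \<subseteq> M" "q ` F \<subseteq> M"
      "M \<subseteq> (\<Sum>i\<in>V. PIdl\<^bsub>poly_ring V\<^esub> (P i)) + (\<Sum>S\<in>F. {Const c * q S | c. True})"
    by (rule generators[OF finV])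
  obtain \<sigma> where \<sigma>: "\<sigma> permutes V" "\<sigma> ` {1..card B} = B" "\<sigma> ` {card B + 1..n} = V - B"
    using permutes_onto_initial_segment[of B n] BV unfolding V_def by metis
  have finB: "finite B"
    using BV by (auto simp: V_def intro: finite_subset)
  obtain e where e: "bij_betw e {1..card F} F"
    using F(1) by (metis ex_bij_betw_nat_finite_1)
  define m where "m = card (V - B)"
  have km: "card B + m = n"
    using card_Diff_subset[OF finB BV] card_mono[OF _ BV] by (simp add: m_def V_def)
  have shift: "\<sigma> (card B + j) \<in> V - B" if "j \<in> {1..m}" for j
    using \<sigma>(3) that km by (auto simp flip: \<sigma>(3))
  \<comment> \<open>Needed to pass from a condition on the indices 1 to m to one on all quadratic
    variables.\<close>
  have unshift: "\<exists>j\<in>{1..m}. i = \<sigma> (card B + j)" if "i \<in> V - B" for i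
  proof -
    obtain l where "l \<in> {card B + 1..n}" "i = \<sigma> l"
      using \<open>i \<in> V - B\<close> unfolding \<sigma>(3)[symmetric] by blast
    then show ?thesis
      using km by (intro bexI[of _ "l - card B"]) auto
  qed
  have N: "card F = (if m = 0 then 0 else 2 ^ (n - card B) - 2)"
  proof -
    have "m = 0 \<longleftrightarrow> V = B" "n - card B = m"
      using BV finV km by (auto simp: m_def)
    then show ?thesis
      using F(2) by (simp add: m_def)
  qed
  let ?p = "\<lambda>j. P (\<sigma> j)" and ?q = "\<lambda>j. q (e j)"
  have \<sigma>_bij: "bij_betw \<sigma> V V"
    using \<sigma>(1) by (rule permutes_imp_bij)
  have images: "?p ` V = P ` V" "?q ` {1..card F} = q ` F"
    using \<sigma>_bij e by (auto simp: bij_betw_def image_image[symmetric, of P \<sigma>] image_image[symmetric, of q e])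
  interpret ideal_plus_span V V ?p "{1..card F}" ?q
    by unfold_locales (auto simp: V_def)
  \<comment> \<open>Both set sums are only reindexed, along the permutation and along the numbering
    \<open>e\<close> of \<open>F\<close>.\<close>
  have W: "W = (\<Sum>i\<in>V. PIdl\<^bsub>poly_ring V\<^esub> (P i)) + (\<Sum>S\<in>F. {Const c * q S | c. True})"
    unfolding W_def
    by (simp only: sum.reindex_bij_betw[OF \<sigma>_bij, of "\<lambda>i. PIdl\<^bsub>poly_ring V\<^esub> (P i)"]
        sum.reindex_bij_betw[OF e, of "\<lambda>S. {Const c * q S | c. True}"])
  have G: "?p ` V \<union> ?q ` {1..card F} \<subseteq> M"
    using gen images by auto
  let ?J = "Idl\<^bsub>poly_ring V\<^esub> (?p ` V \<union> ?q ` {1..card F})"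
  have Gc: "?p ` V \<union> ?q ` {1..card F} \<subseteq> carrier (poly_ring V)"
    using G Icarr by blast
  \<comment> \<open>The cycle of inclusions from M through \<open>W\<close> and \<open>?J\<close>
    back to M yields both descriptions of M at once.\<close>
  have "M \<subseteq> W"
    using gen(3) W by simp
  moreover have "W \<subseteq> ?J"
    using genideal_self[OF Gc] by (intro W_subset_ideal genideal_ideal[OF Gc]) auto
  moreover have "?J \<subseteq> M"
    by (intro genideal_minimal is_ideal G)
  ultimately have eq: "M = ?J" "M = W"
    by auto
  show ?thesis
  proof (intro exI conjI)
    show "\<sigma> permutes {1..n}"
      using \<sigma>(1) by (simp add: V_def)
    show "card B + m = n"
      by (rule km)
    show "\<forall>j\<in>{1..m}. a (\<sigma> (card B + j)) \<notin> \<real>"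
      using a shift by blast
    show "\<forall>j\<in>{1..card B}. ?p j = Var (\<sigma> j) - Const (r (\<sigma> j))"
      using PB \<sigma>(2) by blast
    show "\<forall>j\<in>{1..m}. ?p (card B + j) = Var (\<sigma> (card B + j)) ^ 2
        - Const (2 * Re (a (\<sigma> (card B + j)))) * Var (\<sigma> (card B + j))
        + Const ((cmod (a (\<sigma> (card B + j))))\<^sup>2)"
      using PC shift by (simp add: quad_def)
    show "card F = (if m = 0 then 0 else 2 ^ (n - card B) - 2)"
      by (rule N)
    show "\<forall>j\<in>{1..card F}. ?q j \<in> polys_in (\<sigma> ` {card B + 1..n}) \<and> multilinear (?q j) \<and>
        (\<forall>z. (\<forall>i\<in>{1..m}. z (\<sigma> (card B + i)) = a (\<sigma> (card B + i))) \<longrightarrow> poly_eval z (?q j) = 0)"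
    proof (intro ballI conjI allI impI)
      fix j assume "j \<in> {1..card F}"
      then have j: "e j \<in> F"
        using e by (auto simp: bij_betw_def)
      show "?q j \<in> polys_in (\<sigma> ` {card B + 1..n})"
        using q(1) j by (simp only: \<sigma>(3))
      show "multilinear (?q j)"
        using q(1) j by blast
      fix z assume "\<forall>i\<in>{1..m}. z (\<sigma> (card B + i)) = a (\<sigma> (card B + i))"
      then have "\<forall>i\<in>V - B. z i = a i"
        using unshift by blast
      then show "poly_eval z (?q j) = 0"
        using q(2) j by blast
    qed
    show "M = Idl\<^bsub>poly_ring {1..n}\<^esub> (?p ` {1..n} \<union> ?q ` {1..card F})"
      using eq(1) by (simp only: V_def)
    show "M = (\<Sum>j\<in>{1..n}. PIdl\<^bsub>poly_ring {1..n}\<^esub> (?p j))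
        + (\<Sum>j\<in>{1..card F}. {Const c * ?q j | c. True})"
      using eq(2)[unfolded W_def] by (simp only: V_def)
  qed
qed

end
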